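(* Let $U$ be a bi-potential matrix which is an increasing CBF (constant block form) matrix, and let $f:\mathbb{R}_+\to\mathbb{R}_+$ be a nonnegative strictly increasing convex function. Then $f(U)$, the matrix with entries $f(U_{ij})$, is a bi-potential.
   Context: All matrices are real and square; $'$ denotes transpose; $\mathbf 1_p$ is the vector of ones of size $p$; $\mathbb{R}_+=[0,\infty)$. A nonnegative matrix $V$ is a bi-potential if it is nonsingular and $(V^{-1})_{ij}\le 0$ for $i\neq j$, $(V^{-1})_{ii}>0$, $\sum_j (V^{-1})_{ij}\ge 0$ for every $i$, and $\sum_i (V^{-1})_{ij}\ge 0$ for every $j$. Constant block form (CBF) matrices are defined recursively: every $1\times1$ matrix is CBF, and an $n\times n$ matrix ($n\ge 2$) is CBF if for some $1\le p<n$ it has the form $$U=\begin{pmatrix} A & \alpha \mathbf 1_p\mathbf 1_{n-p}'\\ \beta\mathbf 1_{n-p}\mathbf 1_p' & B\end{pmatrix},$$ with $A,B$ CBF matrices of sizes $p$ and $n-p$ and $\alpha,\beta$ real numbers. $U$ is in increasing CBF if (recursively) $A$ and $B$ are in increasing CBF and every entry of $A$ and of $B$ is $\ge\min\{\alpha,\beta\}$ ($1\times 1$ matrices being increasing CBF). *)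

theory Defs
  imports "Jordan_Normal_Form.Matrix" "HOL-Analysis.Convex"
begin

(* Any W as below is the inverse of V, which is unique. *)
definition bi_potential :: "real mat \<Rightarrow> bool" where
  "bi_potential V \<longleftrightarrow>
     square_mat V \<and> (\<forall>x\<in>elements_mat V. 0 \<le> x) \<and>
     (let n = dim_row V in
      \<exists>W\<in>carrier_mat n n. inverts_mat V W \<and> inverts_mat W V \<and>
        (\<forall>i<n. \<forall>j<n. i \<noteq> j \<longrightarrow> W $$ (i, j) \<le> 0) \<and>
        (\<forall>i<n. 0 < W $$ (i, i)) \<and>
        (\<forall>i<n. 0 \<le> (\<Sum>j<n. W $$ (i, j))) \<and>
        (\<forall>j<n. 0 \<le> (\<Sum>i<n. W $$ (i, j))))"

definition cbf_block :: "real mat \<Rightarrow> real \<Rightarrow> real \<Rightarrow> real mat \<Rightarrow> real mat" where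
  "cbf_block A \<alpha> \<beta> B =
     four_block_mat A (mat (dim_row A) (dim_col B) (\<lambda>_. \<alpha>))
                    (mat (dim_row B) (dim_col A) (\<lambda>_. \<beta>)) B"

inductive cbf :: "real mat \<Rightarrow> bool" where
  one: "A \<in> carrier_mat 1 1 \<Longrightarrow> cbf A"
| block: "cbf A \<Longrightarrow> cbf B \<Longrightarrow> cbf (cbf_block A \<alpha> \<beta> B)"

(* The constraints of all levels refer to one and the same recursive block
   decomposition; being in CBF is implied (increasing_cbf_imp_cbf). *)
inductive increasing_cbf :: "real mat \<Rightarrow> bool" where
  one: "A \<in> carrier_mat 1 1 \<Longrightarrow> increasing_cbf A"
| block: "increasing_cbf A \<Longrightarrow> increasing_cbf B \<Longrightarrow>
    \<forall>x\<in>elements_mat A \<union> elements_mat B. min \<alpha> \<beta> \<le> x \<Longrightarrow>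
    increasing_cbf (cbf_block A \<alpha> \<beta> B)"

lemma increasing_cbf_imp_cbf: "increasing_cbf U \<Longrightarrow> cbf U"
  by (induction rule: increasing_cbf.induct) (auto intro: cbf.intros)

lemma cbf_square: "cbf U \<Longrightarrow> square_mat U \<and> 0 < dim_row U"
  by (induction rule: cbf.induct) (auto simp: cbf_block_def)

end

theory Submission
  imports Defs
begin

text \<open>Let a block matrix have diagonal blocks \<open>A\<close>, \<open>B\<close> and off-diagonal constants \<open>a\<close>, \<open>b\<close>,
  and let \<open>x\<close>, \<open>y\<close> be the reciprocals of the entry sums of the inverses of \<open>A\<close> and \<open>B\<close>. If the
  matrix is a bi-potential, then so are \<open>A\<close> and \<open>B\<close>, and \<open>a, b \<le> x, y\<close>. The reciprocal \<open>z\<close> of the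
  entry sum of the whole inverse satisfies \<open>(x - z) (y - z) = (z - a) (z - b)\<close> and
  \<open>a, b \<le> z \<le> x, y\<close>. Comparing increments of \<open>f\<close> with the slope of \<open>f\<close> on the left of \<open>z\<close> gives
  \<open>(f x - f z) (f y - f z) \<ge> (f z - f a) (f z - f b)\<close>. This propagates the inequality
  ``reciprocal entry sum of the inverse of \<open>f(U)\<close> is at least \<open>f\<close> of that of \<open>U\<close>''
  through the block decomposition, and this inequality makes the diagonal blocks of \<open>f(U)\<close>
  satisfy the same conditions as \<open>A\<close> and \<open>B\<close>. Conversely those conditions and increasingness
  suffice for a bi-potential: only the sign of the inverse inside a diagonal block is not obvious,
  and it concerns a shift of that block by a constant below its smallest entry.

  Matrices are functions on a finite index set \<open>S\<close>, with \<open>w\<close> the inverse of \<open>u\<close> on \<open>S\<close>, so that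
  blocks are subsets and no index shifts occur.\<close>

section \<open>Bi-potentials on finite index sets\<close>

definition row_sum :: "'i set \<Rightarrow> ('i \<Rightarrow> 'i \<Rightarrow> real) \<Rightarrow> 'i \<Rightarrow> real" where
  "row_sum S w i = (\<Sum>j\<in>S. w i j)"

definition entry_sum :: "'i set \<Rightarrow> ('i \<Rightarrow> 'i \<Rightarrow> real) \<Rightarrow> real" where
  "entry_sum S w = (\<Sum>i\<in>S. row_sum S w i)"

text \<open>An input abbreviation, so that double transposes disappear by beta reduction and each
  row statement yields its column version by instantiation.\<close>

abbreviation (input) tr :: "('i \<Rightarrow> 'i \<Rightarrow> real) \<Rightarrow> 'i \<Rightarrow> 'i \<Rightarrow> real" where
  "tr w \<equiv> \<lambda>i j. w j i"

text \<open>That \<open>w\<close> is also a left inverse is expressed as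
  \<open>right_inv S (tr u) (tr w)\<close>.\<close>

definition right_inv :: "'i set \<Rightarrow> ('i \<Rightarrow> 'i \<Rightarrow> real) \<Rightarrow> ('i \<Rightarrow> 'i \<Rightarrow> real) \<Rightarrow> bool" where
  "right_inv S u w \<longleftrightarrow> (\<forall>i\<in>S. \<forall>j\<in>S. (\<Sum>k\<in>S. u i k * w k j) = (if i = j then 1 else 0))"

definition potential_on :: "'i set \<Rightarrow> ('i \<Rightarrow> 'i \<Rightarrow> real) \<Rightarrow> ('i \<Rightarrow> 'i \<Rightarrow> real) \<Rightarrow> bool" where
  "potential_on S u w \<longleftrightarrow> right_inv S u w \<and> (\<forall>i\<in>S. \<forall>j\<in>S. 0 \<le> u i j) \<and>
     (\<forall>i\<in>S. \<forall>j\<in>S. i \<noteq> j \<longrightarrow> w i j \<le> 0) \<and> (\<forall>i\<in>S. 0 \<le> row_sum S w i)"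

definition bipotential_on :: "'i set \<Rightarrow> ('i \<Rightarrow> 'i \<Rightarrow> real) \<Rightarrow> ('i \<Rightarrow> 'i \<Rightarrow> real) \<Rightarrow> bool" where
  "bipotential_on S u w \<longleftrightarrow> potential_on S u w \<and> potential_on S (tr u) (tr w)"

definition block_on :: "'i set \<Rightarrow> 'i set \<Rightarrow> ('i \<Rightarrow> 'i \<Rightarrow> real) \<Rightarrow> real \<Rightarrow> real \<Rightarrow> bool" where
  "block_on S T u a b \<longleftrightarrow> finite S \<and> finite T \<and> S \<noteq> {} \<and> T \<noteq> {} \<and> S \<inter> T = {} \<and>
     (\<forall>i\<in>S. \<forall>j\<in>T. u i j = a \<and> u j i = b)"

lemma bipotential_on_tr: "bipotential_on S (tr u) (tr w) \<longleftrightarrow> bipotential_on S u w"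
  by (auto simp: bipotential_on_def)

lemma block_on_tr: "block_on S T (tr u) b a \<longleftrightarrow> block_on S T u a b"
  by (auto simp: block_on_def)

lemma block_on_swap: "block_on T S u b a \<longleftrightarrow> block_on S T u a b"
  by (auto simp: block_on_def)

lemma entry_sum_tr: "entry_sum S (tr w) = entry_sum S w"
  unfolding entry_sum_def row_sum_def by (rule sum.swap)

lemma row_sum_cong: "(\<And>j. j \<in> S \<Longrightarrow> w i j = w' i j) \<Longrightarrow> row_sum S w i = row_sum S w' i"
  unfolding row_sum_def by (auto intro: sum.cong)

lemma entry_sum_cong: "(\<And>i j. i \<in> S \<Longrightarrow> j \<in> S \<Longrightarrow> w i j = w' i j) \<Longrightarrow> entry_sum S w = entry_sum S w'"
  unfolding entry_sum_def by (auto intro!: sum.cong row_sum_cong)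

lemma potential_on_cong:
  assumes "\<And>i j. i \<in> S \<Longrightarrow> j \<in> S \<Longrightarrow> w i j = w' i j"
  shows "potential_on S u w \<longleftrightarrow> potential_on S u w'"
proof -
  have "row_sum S w i = row_sum S w' i" if "i \<in> S" for i
    using assms that by (auto intro: row_sum_cong)
  moreover have "(\<Sum>k\<in>S. u i k * w k j) = (\<Sum>k\<in>S. u i k * w' k j)" if "j \<in> S" for i j
    using assms that by (auto intro: sum.cong)
  ultimately show ?thesis
    using assms by (simp add: potential_on_def right_inv_def)
qed

lemma right_inv_row_sum:
  assumes "right_inv S u w" "finite S" "i \<in> S"
  shows "(\<Sum>k\<in>S. u i k * row_sum S w k) = 1"
proof -
  have "(\<Sum>k\<in>S. u i k * row_sum S w k) = (\<Sum>j\<in>S. \<Sum>k\<in>S. u i k * w k j)"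
    unfolding row_sum_def sum_distrib_left by (rule sum.swap)
  also have "\<dots> = (\<Sum>j\<in>S. if i = j then 1 else 0)"
    using assms by (intro sum.cong) (auto simp: right_inv_def)
  finally show ?thesis
    using assms by simp
qed

lemma left_inv_solve:
  assumes "right_inv S (tr u) (tr w)" "finite S" "\<And>i. i \<in> S \<Longrightarrow> (\<Sum>k\<in>S. u i k * x k) = y i" "i \<in> S"
  shows "x i = (\<Sum>k\<in>S. w i k * y k)"
proof -
  have "(\<Sum>k\<in>S. w i k * y k) = (\<Sum>k\<in>S. w i k * (\<Sum>l\<in>S. u k l * x l))"
    using assms by (intro sum.cong) auto
  also have "\<dots> = (\<Sum>k\<in>S. \<Sum>l\<in>S. w i k * u k l * x l)"
    by (simp add: sum_distrib_left mult.assoc)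
  also have "\<dots> = (\<Sum>l\<in>S. \<Sum>k\<in>S. w i k * u k l * x l)"
    by (rule sum.swap)
  also have "\<dots> = (\<Sum>l\<in>S. (\<Sum>k\<in>S. u k l * w i k) * x l)"
    by (simp add: sum_distrib_left mult.commute mult.left_commute)
  also have "\<dots> = (\<Sum>l\<in>S. (if l = i then 1 else 0) * x l)"
    using assms by (intro sum.cong) (auto simp: right_inv_def)
  also have "\<dots> = (\<Sum>l\<in>S. if l = i then x l else 0)"
    by (intro sum.cong) auto
  also have "\<dots> = x i"
    using assms by simp
  finally show ?thesis by simp
qed

text \<open>Row sums of the inverse are the solution of \<open>u x = 1\<close>; they can therefore
  be computed by exhibiting a solution of a linear system.\<close>

lemma left_inv_solve_const:
  assumes "right_inv S (tr u) (tr w)" "finite S" "\<And>i. i \<in> S \<Longrightarrow> (\<Sum>k\<in>S. u i k * x k) = c" "i \<in> S"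
  shows "x i = c * row_sum S w i"
  using left_inv_solve[OF assms(1,2), of x "\<lambda>_. c" i] assms(3,4)
  by (simp add: row_sum_def sum_distrib_left mult.commute)

lemma inverse_unique_on:
  assumes "right_inv S (tr u) (tr w)" "right_inv S u w'" "finite S" "i \<in> S" "j \<in> S"
  shows "w' i j = w i j"
proof -
  have "w' i j = (\<Sum>k\<in>S. w i k * (if k = j then 1 else 0))"
    using assms by (intro left_inv_solve[where u = u]) (auto simp: right_inv_def)
  also have "\<dots> = (\<Sum>k\<in>S. if k = j then w i k else 0)"
    by (intro sum.cong) auto
  also have "\<dots> = w i j"
    using assms by simp
  finally show ?thesis .
qed

text \<open>The row sums are nonnegative and cannot all vanish, because \<open>u\<close> maps them
  to the constant 1.\<close>

lemma entry_sum_pos: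
  assumes "potential_on S u w" "finite S" "S \<noteq> {}"
  shows "0 < entry_sum S w"
proof -
  have nn: "0 \<le> row_sum S w i" if "i \<in> S" for i
    using assms that by (auto simp: potential_on_def)
  obtain i where i: "i \<in> S" using assms by auto
  have "(\<Sum>k\<in>S. u i k * row_sum S w k) = 1"
    using assms i by (intro right_inv_row_sum) (auto simp: potential_on_def)
  then have "\<not> (\<forall>k\<in>S. row_sum S w k = 0)"
    by (metis (no_types, lifting) mult_zero_right sum.neutral zero_neq_one)
  then have "entry_sum S w \<noteq> 0"
    unfolding entry_sum_def using assms nn by (simp add: sum_nonneg_eq_0_iff)
  moreover have "0 \<le> entry_sum S w"
    unfolding entry_sum_def using nn by (intro sum_nonneg)
  ultimately show ?thesis by simp
qed

text \<open>Otherwise column \<open>i\<close> of \<open>w\<close> would be nonpositive, and so would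
  be the diagonal entry 1 of the product. This supplies the diagonal condition of
  \<open>bi_potential\<close>, which \<open>potential_on\<close> does not list.\<close>

lemma potential_on_diag_pos:
  assumes "potential_on S u w" "finite S" "i \<in> S"
  shows "0 < w i i"
proof (rule ccontr)
  assume "\<not> 0 < w i i"
  then have "w k i \<le> 0" if "k \<in> S" for k
    using assms that by (cases "k = i") (auto simp: potential_on_def)
  then have "(\<Sum>k\<in>S. u i k * w k i) \<le> 0"
    using assms by (intro sum_nonpos mult_nonneg_nonpos) (auto simp: potential_on_def)
  then show False
    using assms by (auto simp: potential_on_def right_inv_def)
qed

section \<open>Diagonal blocks of a bi-potential\<close>

lemma block_nonneg:
  assumes "block_on S T u a b" "\<forall>i\<in>S \<union> T. \<forall>j\<in>S \<union> T. 0 \<le> u i j"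
  shows "0 \<le> a" "0 \<le> b"
proof -
  obtain i j where "i \<in> S" "j \<in> T" using assms by (auto simp: block_on_def)
  moreover from this have "u i j = a" "u j i = b"
    using assms(1) by (auto simp: block_on_def)
  ultimately have "u i j = a" "u j i = b" "0 \<le> u i j" "0 \<le> u j i"
    using assms(2) by blast+
  then show "0 \<le> a" "0 \<le> b" by auto
qed

text \<open>On \<open>S\<close> the product of \<open>u\<close> and \<open>w\<close> is the identity
  up to a rank-one defect, which comes from the constant \<open>a\<close> and the column sums
  \<open>r\<close> of \<open>w\<close> over the rows in \<open>T\<close>. The defect is removed with
  the vector \<open>p\<close>, which \<open>u\<close> maps to a constant on
  \<open>S\<close>.\<close>

lemma diagonal_block_potential:
  assumes bp: "bipotential_on (S \<union> T) u w" and bl: "block_on S T u a b"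
  shows "\<exists>w'. potential_on S u w' \<and> a * entry_sum S w' \<le> 1"
proof -
  have fin: "finite S" "finite T" and ne: "S \<noteq> {}" "T \<noteq> {}" and dis: "S \<inter> T = {}"
    and ua: "\<And>i j. i \<in> S \<Longrightarrow> j \<in> T \<Longrightarrow> u i j = a"
    using bl by (auto simp: block_on_def)
  have ri: "right_inv (S \<union> T) u w" and li: "right_inv (S \<union> T) (tr u) (tr w)"
    and u0: "\<And>i j. i \<in> S \<union> T \<Longrightarrow> j \<in> S \<union> T \<Longrightarrow> 0 \<le> u i j"
    and off: "\<And>i j. i \<in> S \<union> T \<Longrightarrow> j \<in> S \<union> T \<Longrightarrow> i \<noteq> j \<Longrightarrow> w i j \<le> 0"
    and rs: "\<And>i. i \<in> S \<union> T \<Longrightarrow> 0 \<le> row_sum (S \<union> T) w i"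
    and cs: "\<And>i. i \<in> S \<union> T \<Longrightarrow> 0 \<le> row_sum (S \<union> T) (tr w) i"
    using bp by (auto simp: bipotential_on_def potential_on_def)
  have a0: "0 \<le> a" using block_nonneg[OF bl] u0 by auto
  define p where "p i = row_sum S w i" for i
  define r where "r j = (\<Sum>i\<in>T. w i j)" for j
  define R where "R = (\<Sum>j\<in>S. r j)"
  have off': "w i j \<le> 0" if "i \<in> T" "j \<in> S" for i j using off[of i j] that dis by auto
  have off'': "w i j \<le> 0" if "i \<in> S" "j \<in> T" for i j using off[of i j] that dis by auto
  have r0: "r j \<le> 0" if "j \<in> S" for j
    unfolding r_def using off' that by (intro sum_nonpos)
  have R0: "R \<le> 0" unfolding R_def using r0 by (intro sum_nonpos)
  have p0: "0 \<le> p i" if i: "i \<in> S" for i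
  proof -
    have "0 \<le> p i + (\<Sum>j\<in>T. w i j)"
      using rs[of i] i fin dis unfolding p_def row_sum_def by (simp add: sum.union_disjoint)
    moreover have "(\<Sum>j\<in>T. w i j) \<le> 0" using off'' i by (intro sum_nonpos)
    ultimately show ?thesis by simp
  qed
  have d: "1 \<le> 1 - a * R" using mult_nonneg_nonpos[OF a0 R0] by simp
  \<comment> \<open>The Sherman--Morrison correction: \<open>u\<close> sends \<open>p\<close> to the
    constant \<open>1 - a * R\<close>, so this term cancels \<open>- a * r j\<close> in
    \<open>uw\<close>. Its sign is right, as \<open>p\<close> is nonnegative and \<open>r\<close>
    nonpositive.\<close>
  define w' where "w' i j = w i j + a / (1 - a * R) * p i * r j" for i j
  have uw: "(\<Sum>k\<in>S. u i k * w k j) = (if i = j then 1 else 0) - a * r j"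
    if i: "i \<in> S" and j: "j \<in> S" for i j
  proof -
    have "(\<Sum>k\<in>S. u i k * w k j) + (\<Sum>k\<in>T. u i k * w k j) = (if i = j then 1 else 0)"
      using ri i j fin dis by (simp add: right_inv_def sum.union_disjoint)
    moreover have "(\<Sum>k\<in>T. u i k * w k j) = a * r j"
      unfolding r_def sum_distrib_left using i ua by (intro sum.cong) auto
    ultimately show ?thesis by simp
  qed
  have up: "(\<Sum>k\<in>S. u i k * p k) = 1 - a * R" if i: "i \<in> S" for i
  proof -
    have "(\<Sum>k\<in>S. u i k * p k) = (\<Sum>j\<in>S. \<Sum>k\<in>S. u i k * w k j)"
      unfolding p_def row_sum_def sum_distrib_left by (rule sum.swap)
    also have "\<dots> = (\<Sum>j\<in>S. (if i = j then 1 else 0) - a * r j)"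
      using i uw by (intro sum.cong) auto
    also have "\<dots> = 1 - a * R"
      using i fin by (simp add: sum_subtractf R_def sum_distrib_left)
    finally show ?thesis .
  qed
  have "(\<Sum>k\<in>S. u i k * w' k j) = (if i = j then 1 else 0)" if i: "i \<in> S" and j: "j \<in> S" for i j
  proof -
    have "(\<Sum>k\<in>S. u i k * w' k j)
        = (\<Sum>k\<in>S. u i k * w k j) + a / (1 - a * R) * r j * (\<Sum>k\<in>S. u i k * p k)"
      unfolding w'_def sum_distrib_left sum.distrib[symmetric]
      by (intro sum.cong) (auto simp: algebra_simps)
    then show ?thesis using uw[OF i j] up[OF i] d by simp
  qed
  moreover have "w' i j \<le> 0" if "i \<in> S" "j \<in> S" "i \<noteq> j" for i j
  proof -
    have "a / (1 - a * R) * p i * r j \<le> 0"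
      using a0 d p0 r0 that by (intro mult_nonneg_nonpos mult_nonneg_nonneg divide_nonneg_nonneg) auto
    then show ?thesis using off[of i j] that by (simp add: w'_def)
  qed
  moreover have rw': "row_sum S w' i = p i / (1 - a * R)" for i
  proof -
    have "row_sum S w' i = p i + a / (1 - a * R) * p i * R"
      unfolding row_sum_def w'_def sum.distrib R_def sum_distrib_left p_def by simp
    then show ?thesis using d by (simp add: field_simps)
  qed
  ultimately have "potential_on S u w'"
    using u0 p0 d by (auto simp: potential_on_def right_inv_def)
  moreover have "a * entry_sum S w' \<le> 1"
  proof -
    \<comment> \<open>For a column \<open>j\<close> in \<open>T\<close>, the column sums of
      \<open>w\<close> weighted by \<open>u k j\<close> add up to 1. The terms over \<open>T\<close>
      are nonnegative, and those over \<open>S\<close> all carry the factor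
      \<open>a\<close>.\<close>
    obtain j where j: "j \<in> T" using ne by auto
    have "1 = (\<Sum>k\<in>S \<union> T. u k j * row_sum (S \<union> T) (tr w) k)"
      using right_inv_row_sum[OF li] fin j by simp
    also have "\<dots> = (\<Sum>k\<in>S. u k j * row_sum (S \<union> T) (tr w) k)
                  + (\<Sum>k\<in>T. u k j * row_sum (S \<union> T) (tr w) k)"
      using fin dis by (intro sum.union_disjoint)
    also have "\<dots> \<ge> (\<Sum>k\<in>S. u k j * row_sum (S \<union> T) (tr w) k)"
      using u0 cs j by (simp add: sum_nonneg)
    also have "(\<Sum>k\<in>S. u k j * row_sum (S \<union> T) (tr w) k)
        = a * (\<Sum>k\<in>S. row_sum (S \<union> T) (tr w) k)"
      unfolding sum_distrib_left using ua j by (intro sum.cong) auto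
    also have "(\<Sum>k\<in>S. row_sum (S \<union> T) (tr w) k) = (\<Sum>k\<in>S. row_sum S (tr w) k + r k)"
      using fin dis by (intro sum.cong) (auto simp: row_sum_def r_def sum.union_disjoint)
    also have "\<dots> = (\<Sum>i\<in>S. p i) + R"
      using entry_sum_tr[of S w] by (simp add: sum.distrib R_def entry_sum_def p_def)
    finally have "a * (\<Sum>i\<in>S. p i) \<le> 1 - a * R" by (simp add: algebra_simps)
    moreover have "entry_sum S w' = (\<Sum>i\<in>S. p i) / (1 - a * R)"
      by (simp add: entry_sum_def rw' sum_divide_distrib)
    ultimately show ?thesis using d by simp
  qed
  ultimately show ?thesis by blast
qed

text \<open>The previous lemma is applied to \<open>u\<close> and to its transpose. The two inverses
  coincide, one being a right and the other, transposed, a left inverse.\<close>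

lemma diagonal_block_bipotential:
  assumes bp: "bipotential_on (S \<union> T) u w" and bl: "block_on S T u a b"
  shows "\<exists>w'. bipotential_on S u w' \<and> a * entry_sum S w' \<le> 1 \<and> b * entry_sum S w' \<le> 1"
proof -
  obtain w1 where w1: "potential_on S u w1" "a * entry_sum S w1 \<le> 1"
    using diagonal_block_potential[OF assms] by auto
  obtain w2 where w2: "potential_on S (tr u) w2" "b * entry_sum S w2 \<le> 1"
    using diagonal_block_potential[OF iffD2[OF bipotential_on_tr bp] iffD2[OF block_on_tr bl]]
    by blast
  have eq: "w1 i j = w2 j i" if "i \<in> S" "j \<in> S" for i j
    using inverse_unique_on[of S u "tr w2" w1 i j] that w1 w2 bl
    by (auto simp: potential_on_def block_on_def)
  have "potential_on S (tr u) (tr w1)"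
    using w2(1) potential_on_cong[of S w2 "tr w1" "tr u"] eq by simp
  moreover have "entry_sum S w1 = entry_sum S w2"
    using entry_sum_cong[of S w1 "tr w2", OF eq] entry_sum_tr[of S w2] by simp
  ultimately show ?thesis
    unfolding bipotential_on_def using w1 w2(2) by (intro exI[of _ w1]) simp
qed

section \<open>Linear systems with a block matrix and the entry sum of its inverse\<close>

lemma sum_block:
  assumes "block_on S T u a b"
  shows "i \<in> S \<Longrightarrow> (\<Sum>k\<in>S \<union> T. u i k * x k) = (\<Sum>k\<in>S. u i k * x k) + a * (\<Sum>k\<in>T. x k)"
    and "i \<in> T \<Longrightarrow> (\<Sum>k\<in>S \<union> T. u i k * x k) = b * (\<Sum>k\<in>S. x k) + (\<Sum>k\<in>T. u i k * x k)"
  using assms unfolding block_on_def sum_distrib_left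
  by (simp_all add: sum.union_disjoint)

text \<open>Multiples of the row sums of \<open>w1\<close> on \<open>S\<close> and of
  \<open>w2\<close> on \<open>T\<close> are sent to vectors that are constant on each block, so
  \<open>u x = 1\<close> reduces to a 2 by 2 system for \<open>c\<close> and
  \<open>d\<close>.\<close>

lemma block_solution:
  assumes bl: "block_on S T u a b"
    and r: "right_inv S u w1" "right_inv T u w2"
  defines "x \<equiv> \<lambda>c d i. if i \<in> S then c * row_sum S w1 i else d * row_sum T w2 i"
  shows "i \<in> S \<Longrightarrow> (\<Sum>k\<in>S \<union> T. u i k * x c d k) = c + a * d * entry_sum T w2"
    and "i \<in> T \<Longrightarrow> (\<Sum>k\<in>S \<union> T. u i k * x c d k) = b * c * entry_sum S w1 + d"
    and "(\<Sum>k\<in>S \<union> T. x c d k) = c * entry_sum S w1 + d * entry_sum T w2"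
proof -
  have fin: "finite S" "finite T" and dis: "S \<inter> T = {}"
    using bl by (auto simp: block_on_def)
  have s: "(\<Sum>k\<in>S. x c d k) = c * entry_sum S w1"
    unfolding entry_sum_def sum_distrib_left by (intro sum.cong) (auto simp: x_def)
  have t: "(\<Sum>k\<in>T. x c d k) = d * entry_sum T w2"
    unfolding entry_sum_def sum_distrib_left using dis by (intro sum.cong) (auto simp: x_def)
  have us: "(\<Sum>k\<in>S. u i k * x c d k) = c" if "i \<in> S"
  proof -
    have "(\<Sum>k\<in>S. u i k * x c d k) = c * (\<Sum>k\<in>S. u i k * row_sum S w1 k)"
      unfolding sum_distrib_left by (intro sum.cong) (auto simp: x_def)
    then show ?thesis using right_inv_row_sum[OF r(1) fin(1) that] by simp
  qed
  have ut: "(\<Sum>k\<in>T. u i k * x c d k) = d" if "i \<in> T"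
  proof -
    have "(\<Sum>k\<in>T. u i k * x c d k) = d * (\<Sum>k\<in>T. u i k * row_sum T w2 k)"
      unfolding sum_distrib_left using dis by (intro sum.cong) (auto simp: x_def)
    then show ?thesis using right_inv_row_sum[OF r(2) fin(2) that] by simp
  qed
  show "i \<in> S \<Longrightarrow> (\<Sum>k\<in>S \<union> T. u i k * x c d k) = c + a * d * entry_sum T w2"
    using sum_block(1)[OF bl] us t by simp
  show "i \<in> T \<Longrightarrow> (\<Sum>k\<in>S \<union> T. u i k * x c d k) = b * c * entry_sum S w1 + d"
    using sum_block(2)[OF bl] ut s by simp
  show "(\<Sum>k\<in>S \<union> T. x c d k) = c * entry_sum S w1 + d * entry_sum T w2"
    using s t fin dis by (simp add: sum.union_disjoint)
qed

lemma block_entry_sum: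
  assumes bp: "bipotential_on (S \<union> T) u w" and bl: "block_on S T u a b"
    and p1: "potential_on S u w1" and p2: "potential_on T u w2"
    and a1: "a * entry_sum S w1 \<le> 1" and a2: "b * entry_sum T w2 \<le> 1"
  defines "m1 \<equiv> entry_sum S w1" and "m2 \<equiv> entry_sum T w2"
  shows "a * b * m1 * m2 < 1"
    and "entry_sum (S \<union> T) w = (m1 + m2 - (a + b) * m1 * m2) / (1 - a * b * m1 * m2)"
proof -
  have fin: "finite S" "finite T" and ne: "S \<noteq> {}" "T \<noteq> {}" and dis: "S \<inter> T = {}"
    using bl by (auto simp: block_on_def)
  have li: "right_inv (S \<union> T) (tr u) (tr w)"
    using bp by (auto simp: bipotential_on_def potential_on_def)
  have nn: "0 \<le> a" "0 \<le> b"
    using block_nonneg[OF bl] bp by (auto simp: bipotential_on_def potential_on_def)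
  have m: "0 < m1" "0 < m2"
    using entry_sum_pos p1 p2 fin ne by (auto simp: m1_def m2_def)
  have r: "right_inv S u w1" "right_inv T u w2"
    using p1 p2 by (auto simp: potential_on_def)
  note sol = block_solution[OF bl r, folded m1_def m2_def]
  let ?x = "\<lambda>c d i. if i \<in> S then c * row_sum S w1 i else d * row_sum T w2 i"
  have le: "(a * m1) * (b * m2) \<le> 1"
    using a1 a2 nn m mult_mono[of "a * m1" 1 "b * m2" 1] by (simp add: m1_def m2_def)
  \<comment> \<open>If the determinant vanished, the coefficients \<open>1\<close> and
    \<open>- b * m1\<close> would give a kernel vector of the invertible \<open>u\<close>, and the
    row sums of \<open>w1\<close> would all be zero.\<close>
  have "a * b * m1 * m2 \<noteq> 1"
  proof
    assume eq: "a * b * m1 * m2 = 1"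
    have "(\<Sum>k\<in>S \<union> T. u i k * ?x 1 (- b * m1) k) = 0" if "i \<in> S \<union> T" for i
      using that sol(1)[of i 1 "- b * m1"] sol(2)[of i 1 "- b * m1"] eq by (auto simp: algebra_simps)
    then have "?x 1 (- b * m1) i = 0" if "i \<in> S \<union> T" for i
      using left_inv_solve_const[OF li, of "?x 1 (- b * m1)" 0 i] that fin by simp
    then have "row_sum S w1 i = 0" if "i \<in> S" for i
      using that by force
    then have "m1 = 0" by (simp add: m1_def entry_sum_def)
    then show False using m by simp
  qed
  then show lt: "a * b * m1 * m2 < 1" using le by (simp add: algebra_simps)
  define D where "D = 1 - a * b * m1 * m2"
  have D: "0 < D" using lt by (simp add: D_def)
  \<comment> \<open>Cramer's rule for \<open>c + a * m2 * d = 1\<close> and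
    \<open>b * m1 * c + d = 1\<close>.\<close>
  let ?c = "(1 - a * m2) / D" and ?d = "(1 - b * m1) / D"
  have e1: "?c + a * ?d * m2 = 1" and e2: "b * ?c * m1 + ?d = 1"
    using D by (simp_all add: divide_simps) (simp_all add: D_def algebra_simps)
  have "(\<Sum>k\<in>S \<union> T. u i k * ?x ?c ?d k) = 1" if "i \<in> S \<union> T" for i
    using that sol(1)[of i ?c ?d] sol(2)[of i ?c ?d] e1 e2 by auto
  then have "?x ?c ?d i = row_sum (S \<union> T) w i" if "i \<in> S \<union> T" for i
    using left_inv_solve_const[OF li, of "?x ?c ?d" 1 i] that fin by simp
  then have "entry_sum (S \<union> T) w = (\<Sum>k\<in>S \<union> T. ?x ?c ?d k)"
    unfolding entry_sum_def by (intro sum.cong) auto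
  also have "\<dots> = ?c * m1 + ?d * m2" by (rule sol(3))
  also have "\<dots> = (m1 + m2 - (a + b) * m1 * m2) / D"
    by (simp add: add_divide_distrib[symmetric] algebra_simps)
  finally show "entry_sum (S \<union> T) w = (m1 + m2 - (a + b) * m1 * m2) / (1 - a * b * m1 * m2)"
    by (simp add: D_def)
qed

section \<open>Assembling a bi-potential from blocks\<close>

text \<open>The shift \<^term>\<open>\<lambda>i j. v i j - t\<close> has the inverse
  \<^term>\<open>\<lambda>i j. w i j + s * row_sum S w i * row_sum S (tr w) j\<close> with
  \<^term>\<open>s = t / (1 - t * entry_sum S w)\<close>, that is, \<^term>\<open>t = s / (1 + s * entry_sum S w)\<close>:
  all shifts that keep the entries nonnegative leave the off-diagonal entries of the inverse
  nonpositive.\<close>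

definition shift_stable :: "'i set \<Rightarrow> ('i \<Rightarrow> 'i \<Rightarrow> real) \<Rightarrow> ('i \<Rightarrow> 'i \<Rightarrow> real) \<Rightarrow> bool" where
  "shift_stable S v w \<longleftrightarrow>
     (\<forall>s\<ge>0. (\<forall>i\<in>S. \<forall>j\<in>S. s \<le> v i j * (1 + s * entry_sum S w)) \<longrightarrow>
       (\<forall>i\<in>S. \<forall>j\<in>S. i \<noteq> j \<longrightarrow> w i j + s * row_sum S w i * row_sum S (tr w) j \<le> 0))"

text \<open>The inverse of a block matrix, from the Schur complement and the Sherman--Morrison formula.\<close>

definition block_inv ::
  "'i set \<Rightarrow> 'i set \<Rightarrow> ('i \<Rightarrow> 'i \<Rightarrow> real) \<Rightarrow> ('i \<Rightarrow> 'i \<Rightarrow> real) \<Rightarrow> real \<Rightarrow> real \<Rightarrow> 'i \<Rightarrow> 'i \<Rightarrow> real" where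
  "block_inv S T w1 w2 a b i j =
     (let D = 1 - a * b * entry_sum S w1 * entry_sum T w2 in
      if i \<in> S then
        if j \<in> S then w1 i j + a * b * entry_sum T w2 / D * row_sum S w1 i * row_sum S (tr w1) j
        else - a / D * row_sum S w1 i * row_sum T (tr w2) j
      else
        if j \<in> S then - b / D * row_sum T w2 i * row_sum S (tr w1) j
        else w2 i j + a * b * entry_sum S w1 / D * row_sum T w2 i * row_sum T (tr w2) j)"

text \<open>The inequalities found for the diagonal blocks of a bi-potential, now as hypotheses for
  assembling one. They make the row and column sums of \<open>block_inv\<close> nonnegative; the
  strict one keeps its denominator positive.\<close>

definition blocks_ok ::
  "'i set \<Rightarrow> 'i set \<Rightarrow> ('i \<Rightarrow> 'i \<Rightarrow> real) \<Rightarrow> ('i \<Rightarrow> 'i \<Rightarrow> real) \<Rightarrow> ('i \<Rightarrow> 'i \<Rightarrow> real) \<Rightarrow> real \<Rightarrow> real \<Rightarrow> bool"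
  where
  "blocks_ok S T v w1 w2 a b \<longleftrightarrow>
     block_on S T v a b \<and> bipotential_on S v w1 \<and> bipotential_on T v w2 \<and> 0 \<le> a \<and> 0 \<le> b \<and>
     a * entry_sum S w1 \<le> 1 \<and> b * entry_sum S w1 \<le> 1 \<and>
     a * entry_sum T w2 \<le> 1 \<and> b * entry_sum T w2 \<le> 1 \<and>
     a * b * entry_sum S w1 * entry_sum T w2 < 1"

text \<open>Exchanging the blocks and transposing preserve all conditions, so the main computations
  are done only for a row index in \<open>S\<close>.\<close>

lemma blocks_ok_swap: "blocks_ok S T v w1 w2 a b \<Longrightarrow> blocks_ok T S v w2 w1 b a"
  unfolding blocks_ok_def block_on_swap[of T S v b a] by (simp add: mult_ac)

lemma blocks_ok_tr: "blocks_ok S T v w1 w2 a b \<Longrightarrow> blocks_ok S T (tr v) (tr w1) (tr w2) b a"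
  unfolding blocks_ok_def entry_sum_tr[of S w1] entry_sum_tr[of T w2] block_on_tr[of S T v]
    bipotential_on_tr[of S v w1] bipotential_on_tr[of T v w2]
  by (simp add: mult_ac)

lemma block_inv_swap:
  assumes "S \<inter> T = {}" "i \<in> S \<union> T" "j \<in> S \<union> T"
  shows "block_inv T S w2 w1 b a i j = block_inv S T w1 w2 a b i j"
proof -
  have "i \<in> T \<longleftrightarrow> i \<notin> S" "j \<in> T \<longleftrightarrow> j \<notin> S" using assms by auto
  then show ?thesis by (simp add: block_inv_def Let_def mult_ac)
qed

lemma block_inv_tr: "tr (block_inv S T w1 w2 a b) = block_inv S T (tr w1) (tr w2) b a"
  unfolding block_inv_def entry_sum_tr[of S w1] entry_sum_tr[of T w2]
  by (intro ext) (simp add: Let_def mult_ac)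

section \<open>The assembled matrix is an inverse; its row sums\<close>

lemma block_inv_right_inv_row:
  assumes ok: "blocks_ok S T v w1 w2 a b" and i: "i \<in> S" and j: "j \<in> S \<union> T"
  shows "(\<Sum>k\<in>S \<union> T. v i k * block_inv S T w1 w2 a b k j) = (if i = j then 1 else 0)"
proof -
  define D where "D = 1 - a * b * entry_sum S w1 * entry_sum T w2"
  have D: "0 < D" and bl: "block_on S T v a b" using ok by (auto simp: D_def blocks_ok_def)
  have fin: "finite S" "finite T" and dis: "S \<inter> T = {}" and nT: "\<And>k. k \<in> T \<Longrightarrow> k \<notin> S"
    using bl by (auto simp: block_on_def)
  have r1: "right_inv S v w1"
    using ok by (auto simp: blocks_ok_def bipotential_on_def potential_on_def)
  note e = right_inv_row_sum[OF r1 fin(1) i]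
  note B = block_inv_def[of S T w1 w2 a b, folded D_def, unfolded Let_def]
  show ?thesis
  proof (cases "j \<in> S")
    case True
    let ?c = "a * b * entry_sum T w2 / D * row_sum S (tr w1) j"
    have "(\<Sum>k\<in>S. v i k * block_inv S T w1 w2 a b k j)
        = (\<Sum>k\<in>S. v i k * w1 k j) + ?c * (\<Sum>k\<in>S. v i k * row_sum S w1 k)"
      unfolding sum_distrib_left sum.distrib[symmetric] using True
      by (intro sum.cong) (auto simp: B D_def[symmetric] algebra_simps)
    moreover have "(\<Sum>k\<in>T. block_inv S T w1 w2 a b k j)
        = - b / D * row_sum S (tr w1) j * entry_sum T w2"
      unfolding entry_sum_def sum_distrib_left using True nT
      by (intro sum.cong) (auto simp: B D_def[symmetric] mult_ac)
    ultimately show ?thesis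
      using sum_block(1)[OF bl i] r1 i True e by (simp add: right_inv_def)
  next
    case False
    then have jT: "j \<in> T" "i \<noteq> j" using i j by auto
    have "(\<Sum>k\<in>S. v i k * block_inv S T w1 w2 a b k j)
        = - a / D * row_sum T (tr w2) j * (\<Sum>k\<in>S. v i k * row_sum S w1 k)"
      unfolding sum_distrib_left using False
      by (intro sum.cong) (auto simp: B D_def[symmetric] mult_ac)
    moreover have "(\<Sum>k\<in>T. block_inv S T w1 w2 a b k j)
        = row_sum T (tr w2) j + a * b * entry_sum S w1 / D * row_sum T (tr w2) j * entry_sum T w2"
    proof -
      have "(\<Sum>k\<in>T. block_inv S T w1 w2 a b k j)
          = (\<Sum>k\<in>T. w2 k j + a * b * entry_sum S w1 / D * row_sum T (tr w2) j * row_sum T w2 k)"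
        using False nT by (intro sum.cong) (auto simp: B D_def[symmetric] mult_ac)
      also have "\<dots> = (\<Sum>k\<in>T. w2 k j) + a * b * entry_sum S w1 / D * row_sum T (tr w2) j
          * (\<Sum>k\<in>T. row_sum T w2 k)"
        by (simp only: sum.distrib sum_distrib_left)
      finally show ?thesis
        by (simp only: entry_sum_def[of T] row_sum_def[of T "tr w2"])
    qed
    \<comment> \<open>The coefficient of \<open>r\<close> is
      \<open>- a / D + a + a * (1 - D) / D\<close>, which is 0.\<close>
    moreover have "- a / D * r + a * (r + a * b * entry_sum S w1 / D * r * entry_sum T w2) = 0" for r
      using D by (simp add: field_simps) (simp add: D_def algebra_simps)
    ultimately show ?thesis
      using sum_block(1)[OF bl i] jT e by simp
  qed
qed

lemma block_inv_right_inv: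
  assumes ok: "blocks_ok S T v w1 w2 a b"
  shows "right_inv (S \<union> T) v (block_inv S T w1 w2 a b)"
  unfolding right_inv_def
proof (intro ballI)
  fix i j assume i: "i \<in> S \<union> T" and j: "j \<in> S \<union> T"
  show "(\<Sum>k\<in>S \<union> T. v i k * block_inv S T w1 w2 a b k j) = (if i = j then 1 else 0)"
  proof (cases "i \<in> S")
    case True
    then show ?thesis using block_inv_right_inv_row[OF ok _ j] by simp
  next
    case False
    have dis: "S \<inter> T = {}" using ok by (auto simp: blocks_ok_def block_on_def)
    have "(\<Sum>k\<in>S \<union> T. v i k * block_inv S T w1 w2 a b k j)
        = (\<Sum>k\<in>T \<union> S. v i k * block_inv T S w2 w1 b a k j)"
      using block_inv_swap[OF dis _ j, of _ w2 w1 b a] by (intro sum.cong) auto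
    then show ?thesis
      using block_inv_right_inv_row[OF blocks_ok_swap[OF ok], of i j] False i j by auto
  qed
qed

lemma block_inv_row_sum:
  assumes ok: "blocks_ok S T v w1 w2 a b" and i: "i \<in> S"
  shows "row_sum (S \<union> T) (block_inv S T w1 w2 a b) i
    = row_sum S w1 i * (1 - a * entry_sum T w2) / (1 - a * b * entry_sum S w1 * entry_sum T w2)"
proof -
  define D where "D = 1 - a * b * entry_sum S w1 * entry_sum T w2"
  have D: "0 < D" and bl: "block_on S T v a b" using ok by (auto simp: D_def blocks_ok_def)
  have fin: "finite S" "finite T" and dis: "S \<inter> T = {}" and nT: "\<And>k. k \<in> T \<Longrightarrow> k \<notin> S"
    using bl by (auto simp: block_on_def)
  note B = block_inv_def[of S T w1 w2 a b, folded D_def, unfolded Let_def]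
  have m1: "(\<Sum>j\<in>S. row_sum S (tr w1) j) = entry_sum S w1"
    using entry_sum_tr[of S w1] by (simp add: entry_sum_def)
  have m2: "(\<Sum>j\<in>T. row_sum T (tr w2) j) = entry_sum T w2"
    using entry_sum_tr[of T w2] by (simp add: entry_sum_def)
  have "(\<Sum>j\<in>S. block_inv S T w1 w2 a b i j)
      = (\<Sum>j\<in>S. w1 i j + a * b * entry_sum T w2 / D * row_sum S w1 i * row_sum S (tr w1) j)"
    using i by (intro sum.cong) (auto simp: B D_def[symmetric])
  also have "\<dots> = (\<Sum>j\<in>S. w1 i j) + a * b * entry_sum T w2 / D * row_sum S w1 i * entry_sum S w1"
    by (simp only: sum.distrib sum_distrib_left m1[symmetric])
  finally have "(\<Sum>j\<in>S. block_inv S T w1 w2 a b i j)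
      = row_sum S w1 i + a * b * entry_sum T w2 / D * row_sum S w1 i * entry_sum S w1"
    by (simp only: row_sum_def[of S w1, symmetric])
  moreover have "(\<Sum>j\<in>T. block_inv S T w1 w2 a b i j)
      = - a / D * row_sum S w1 i * entry_sum T w2"
    unfolding m2[symmetric] sum_distrib_left using i nT
    by (intro sum.cong) (auto simp: B D_def[symmetric])
  ultimately have "row_sum (S \<union> T) (block_inv S T w1 w2 a b) i
      = row_sum S w1 i + a * b * entry_sum T w2 / D * row_sum S w1 i * entry_sum S w1
        - a / D * row_sum S w1 i * entry_sum T w2"
    using fin dis unfolding row_sum_def[of "S \<union> T"] by (simp add: sum.union_disjoint)
  also have "\<dots> = row_sum S w1 i * (1 - a * entry_sum T w2) / D"
    using D by (simp add: field_simps) (simp add: D_def algebra_simps)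
  finally show ?thesis by (simp add: D_def)
qed

lemma block_inv_row_sum_swap:
  assumes ok: "blocks_ok S T v w1 w2 a b" and i: "i \<in> T"
  shows "row_sum (S \<union> T) (block_inv S T w1 w2 a b) i
    = row_sum T w2 i * (1 - b * entry_sum S w1) / (1 - a * b * entry_sum S w1 * entry_sum T w2)"
proof -
  have dis: "S \<inter> T = {}" using ok by (auto simp: blocks_ok_def block_on_def)
  have "row_sum (S \<union> T) (block_inv S T w1 w2 a b) i = row_sum (S \<union> T) (block_inv T S w2 w1 b a) i"
    using block_inv_swap[OF dis, of i _ w2 w1 b a] i by (intro row_sum_cong) simp
  then show ?thesis
    using block_inv_row_sum[OF blocks_ok_swap[OF ok] i] by (simp add: Un_commute mult_ac)
qed

section \<open>Signs in the inverse of a shifted block matrix\<close>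

lemma shifted_off_block_bound:
  fixes s a b m1 m2 :: real
  defines "D \<equiv> 1 - a * b * m1 * m2"
  assumes "0 < D" "s \<le> a * (1 + s * ((m1 + m2 - (a + b) * m1 * m2) / D))"
  shows "s * (1 - a * m1) * (1 - a * m2) \<le> a * D"
proof -
  have "s * D \<le> a * (1 + s * ((m1 + m2 - (a + b) * m1 * m2) / D)) * D"
    using assms by (intro mult_right_mono) auto
  also have "\<dots> = a * D + a * s * (m1 + m2 - (a + b) * m1 * m2)"
    using \<open>0 < D\<close> by (simp add: field_simps)
  \<comment> \<open>Uses \<open>D - a * (m1 + m2 - (a + b) * m1 * m2) = (1 - a * m1) * (1 - a *
    m2)\<close>.\<close>
  finally show ?thesis by (simp add: D_def algebra_simps)
qed

text \<open>Inside the block \<open>S\<close>, the rank-one terms of \<open>block_inv\<close> and of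
  the outer shift by \<open>s\<close> are both multiples of the product of row and column sums of
  \<open>w1\<close>, and \<open>s1\<close> is their combined coefficient. The conclusion says that
  \<open>s1\<close> is an admissible shift of \<open>w1\<close> as far as the entry value
  \<open>a\<close> is concerned.\<close>

lemma shifted_diag_block_bound:
  fixes s a b m1 m2 :: real
  defines "D \<equiv> 1 - a * b * m1 * m2"
  assumes D: "0 < D" and s: "s \<le> a * (1 + s * ((m1 + m2 - (a + b) * m1 * m2) / D))"
    and b: "b * m2 \<le> 1"
  defines "s1 \<equiv> a * b * m2 / D + s * ((1 - a * m2) / D) * ((1 - b * m2) / D)"
  shows "s1 \<le> a * (1 + s1 * m1)"
proof -
  have "s1 * (1 - a * m1) * D
      = a * b * m2 * (1 - a * m1) + (1 - b * m2) * (s * (1 - a * m1) * (1 - a * m2)) / D"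
    using D unfolding s1_def by (simp add: field_simps)
  also have "\<dots> \<le> a * b * m2 * (1 - a * m1) + (1 - b * m2) * (a * D) / D"
    using D b shifted_off_block_bound[of a b m1 m2 s] s
    by (intro add_left_mono divide_right_mono mult_left_mono) (auto simp: D_def)
  \<comment> \<open>Uses \<open>b * m2 * (1 - a * m1) + (1 - b * m2) = D\<close>.\<close>
  also have "\<dots> = a * D"
    using D by simp (simp add: D_def algebra_simps)
  finally have "s1 * (1 - a * m1) \<le> a" using D by simp
  then show ?thesis by (simp add: algebra_simps)
qed

text \<open>For \<open>j\<close> in \<open>S\<close> the claim is shift stability of
  \<open>w1\<close> at the combined shift \<open>s1\<close>; for \<open>j\<close> in
  \<open>T\<close> it is \<open>shifted_off_block_bound\<close>. Increasingness enters through
  \<open>mn\<close>: a shift admissible for the values \<open>a\<close> and \<open>b\<close> is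
  admissible for all entries of the block. The number \<open>m\<close> is the entry sum of
  \<open>block_inv\<close>.\<close>

lemma block_inv_shift_row:
  assumes ok: "blocks_ok S T v w1 w2 a b" and st: "shift_stable S v w1"
    and mn: "\<forall>i\<in>S. \<forall>j\<in>S. min a b \<le> v i j"
  defines "m \<equiv> (entry_sum S w1 + entry_sum T w2 - (a + b) * entry_sum S w1 * entry_sum T w2) /
      (1 - a * b * entry_sum S w1 * entry_sum T w2)"
    and "w \<equiv> block_inv S T w1 w2 a b"
  assumes s: "0 \<le> s" and sm: "\<forall>i\<in>S \<union> T. \<forall>j\<in>S \<union> T. s \<le> v i j * (1 + s * m)"
    and i: "i \<in> S" and j: "j \<in> S \<union> T" "i \<noteq> j"
  shows "w i j + s * row_sum (S \<union> T) w i * row_sum (S \<union> T) (tr w) j \<le> 0"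
proof -
  define m1 m2 D where "m1 = entry_sum S w1" and "m2 = entry_sum T w2" and "D = 1 - a * b * m1 * m2"
  have D: "0 < D" and bl: "block_on S T v a b" and ab: "0 \<le> a" "0 \<le> b"
    and le: "a * m1 \<le> 1" "b * m1 \<le> 1" "a * m2 \<le> 1" "b * m2 \<le> 1"
    and p1: "potential_on S v w1" "potential_on S (tr v) (tr w1)"
    and p2: "potential_on T v w2" "potential_on T (tr v) (tr w2)"
    using ok by (auto simp: D_def m1_def m2_def blocks_ok_def bipotential_on_def)
  have fin: "finite S" "finite T" and ne: "S \<noteq> {}" "T \<noteq> {}" and nT: "\<And>k. k \<in> T \<Longrightarrow> k \<notin> S"
    using bl by (auto simp: block_on_def)
  have m: "0 < m1" "0 < m2"
    using entry_sum_pos p1 p2 fin ne by (auto simp: m1_def m2_def)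
  have l: "0 \<le> row_sum S w1 i"
    using p1 i by (auto simp: potential_on_def)
  have rw: "row_sum (S \<union> T) w i = row_sum S w1 i * (1 - a * m2) / D"
    using block_inv_row_sum[OF ok i] by (simp add: w_def m1_def m2_def D_def)
  have me: "m = (m1 + m2 - (a + b) * m1 * m2) / D"
    by (simp add: m_def m1_def m2_def D_def)
  have tw: "tr w = block_inv S T (tr w1) (tr w2) b a"
    unfolding w_def by (rule block_inv_tr)
  note B = block_inv_def[of S T w1 w2 a b, folded m1_def m2_def, folded D_def, unfolded Let_def,
      folded w_def]
  \<comment> \<open>Both blocks are nonempty, so \<open>a\<close> and \<open>b\<close> occur as
    entries and \<open>s\<close> is admissible for them.\<close>
  have sa: "s \<le> a * (1 + s * m)" and sb: "s \<le> b * (1 + s * m)"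
  proof -
    obtain k l where "k \<in> S" "l \<in> T" using ne by auto
    moreover from this have "v k l = a" "v l k = b" using bl by (auto simp: block_on_def)
    ultimately show "s \<le> a * (1 + s * m)" "s \<le> b * (1 + s * m)"
      using sm by (metis UnI1 UnI2)+
  qed
  show ?thesis
  proof (cases "j \<in> S")
    case True
    have rt: "row_sum (S \<union> T) (tr w) j = row_sum S (tr w1) j * (1 - b * m2) / D"
      unfolding tw block_inv_row_sum[OF blocks_ok_tr[OF ok] True]
      using entry_sum_tr[of S w1] entry_sum_tr[of T w2] by (simp add: m1_def m2_def D_def mult_ac)
    define s1 where "s1 = a * b * m2 / D + s * ((1 - a * m2) / D) * ((1 - b * m2) / D)"
    have s1: "0 \<le> s1"
      unfolding s1_def using ab D s le m
      by (intro add_nonneg_nonneg divide_nonneg_nonneg mult_nonneg_nonneg) auto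
    have "s1 \<le> a * (1 + s1 * m1)"
      using shifted_diag_block_bound[of a b m1 m2 s] D sa le me by (simp add: s1_def D_def)
    \<comment> \<open>Both \<open>s1\<close> and \<open>m\<close> are symmetric in \<open>a\<close>
      and \<open>b\<close>, so the bound also holds with these exchanged.\<close>
    moreover have "s1 \<le> b * (1 + s1 * m1)"
    proof -
      have "s1 = b * a * m2 / (1 - b * a * m1 * m2)
          + s * ((1 - b * m2) / (1 - b * a * m1 * m2)) * ((1 - a * m2) / (1 - b * a * m1 * m2))"
        by (simp add: s1_def D_def mult_ac)
      moreover have "m = (m1 + m2 - (b + a) * m1 * m2) / (1 - b * a * m1 * m2)"
        by (simp add: me D_def mult_ac add_ac)
      ultimately show ?thesis
        using shifted_diag_block_bound[of b a m1 m2 s] D sb le by (simp add: D_def mult_ac)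
    qed
    ultimately have "s1 \<le> min a b * (1 + s1 * m1)" by (simp add: min_def)
    moreover have "min a b * (1 + s1 * m1) \<le> v k l * (1 + s1 * m1)" if "k \<in> S" "l \<in> S" for k l
      using mn that s1 m by (intro mult_right_mono) auto
    ultimately have "\<forall>k\<in>S. \<forall>l\<in>S. s1 \<le> v k l * (1 + s1 * m1)" by force
    then have "w1 i j + s1 * row_sum S w1 i * row_sum S (tr w1) j \<le> 0"
      using st s1 i True j by (simp add: shift_stable_def m1_def)
    also have "w1 i j + s1 * row_sum S w1 i * row_sum S (tr w1) j
        = w i j + s * row_sum (S \<union> T) w i * row_sum (S \<union> T) (tr w) j"
      unfolding rw rt s1_def using i True D by (simp add: B field_simps)
    finally show ?thesis .
  next
    case False
    then have jT: "j \<in> T" using j by auto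
    have rt: "row_sum (S \<union> T) (tr w) j = row_sum T (tr w2) j * (1 - a * m1) / D"
      unfolding tw block_inv_row_sum_swap[OF blocks_ok_tr[OF ok] jT]
      using entry_sum_tr[of S w1] entry_sum_tr[of T w2] by (simp add: m1_def m2_def D_def mult_ac)
    have l': "0 \<le> row_sum T (tr w2) j"
      using p2 jT by (auto simp: potential_on_def)
    have "s * (1 - a * m1) * (1 - a * m2) \<le> a * D"
      using shifted_off_block_bound[of a b m1 m2 s] D sa me by (simp add: D_def)
    then have "s * (1 - a * m1) * (1 - a * m2) - a * D \<le> 0" by simp
    then have "row_sum S w1 i * row_sum T (tr w2) j / D\<^sup>2
        * (s * (1 - a * m1) * (1 - a * m2) - a * D) \<le> 0"
      using l l' by (intro mult_nonneg_nonpos divide_nonneg_nonneg mult_nonneg_nonneg) auto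
    also have "row_sum S w1 i * row_sum T (tr w2) j / D\<^sup>2
        * (s * (1 - a * m1) * (1 - a * m2) - a * D)
        = w i j + s * row_sum (S \<union> T) w i * row_sum (S \<union> T) (tr w) j"
      unfolding rw rt using i False D by (simp add: B field_simps power2_eq_square)
    finally show ?thesis .
  qed
qed

lemma block_inv_entry_sum:
  assumes ok: "blocks_ok S T v w1 w2 a b"
  defines "m1 \<equiv> entry_sum S w1" and "m2 \<equiv> entry_sum T w2"
  shows "entry_sum (S \<union> T) (block_inv S T w1 w2 a b)
    = (m1 + m2 - (a + b) * m1 * m2) / (1 - a * b * m1 * m2)"
proof -
  have fin: "finite S" "finite T" and dis: "S \<inter> T = {}"
    using ok by (auto simp: blocks_ok_def block_on_def)
  let ?D = "1 - a * b * m1 * m2"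
  have "entry_sum (S \<union> T) (block_inv S T w1 w2 a b)
      = (\<Sum>i\<in>S. row_sum S w1 i * ((1 - a * m2) / ?D)) + (\<Sum>i\<in>T. row_sum T w2 i * ((1 - b * m1) / ?D))"
    unfolding entry_sum_def[of "S \<union> T"] sum.union_disjoint[OF fin dis]
    using block_inv_row_sum[OF ok] block_inv_row_sum_swap[OF ok] by (simp add: m1_def m2_def)
  also have "\<dots> = m1 * ((1 - a * m2) / ?D) + m2 * ((1 - b * m1) / ?D)"
    unfolding sum_distrib_right[symmetric] by (simp add: m1_def m2_def entry_sum_def)
  also have "\<dots> = (m1 + m2 - (a + b) * m1 * m2) / ?D"
    by (simp add: add_divide_distrib[symmetric] algebra_simps)
  finally show ?thesis .
qed

text \<open>The term added to \<open>w1\<close> or \<open>w2\<close> in a diagonal block is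
  nonnegative, so a bare sign condition would not carry over from the blocks to the whole; shift
  stability does.\<close>

lemma block_inv_shift_stable:
  assumes ok: "blocks_ok S T v w1 w2 a b" and st: "shift_stable S v w1" "shift_stable T v w2"
    and mn: "\<forall>i\<in>S. \<forall>j\<in>S. min a b \<le> v i j" "\<forall>i\<in>T. \<forall>j\<in>T. min a b \<le> v i j"
  shows "shift_stable (S \<union> T) v (block_inv S T w1 w2 a b)"
  unfolding shift_stable_def
proof (intro allI impI ballI)
  let ?w = "block_inv S T w1 w2 a b" and ?w' = "block_inv T S w2 w1 b a"
  fix s i j
  assume s: "0 \<le> s" and sm: "\<forall>i\<in>S \<union> T. \<forall>j\<in>S \<union> T. s \<le> v i j * (1 + s * entry_sum (S \<union> T) ?w)"
    and i: "i \<in> S \<union> T" and j: "j \<in> S \<union> T" and ij: "i \<noteq> j"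
  show "?w i j + s * row_sum (S \<union> T) ?w i * row_sum (S \<union> T) (tr ?w) j \<le> 0"
  proof (cases "i \<in> S")
    case True
    then show ?thesis
      using block_inv_shift_row[OF ok st(1) mn(1) s _ _ j ij] sm
      unfolding block_inv_entry_sum[OF ok] by blast
  next
    case False
    have dis: "S \<inter> T = {}" using ok by (auto simp: blocks_ok_def block_on_def)
    note sw = block_inv_swap[OF dis, of _ _ w2 w1 b a]
    have "entry_sum (S \<union> T) ?w = entry_sum (T \<union> S) ?w'"
      using sw entry_sum_cong[of "S \<union> T" ?w' ?w] by (simp add: Un_commute)
    then have "?w' i j + s * row_sum (T \<union> S) ?w' i * row_sum (T \<union> S) (tr ?w') j \<le> 0"
      using block_inv_shift_row[OF blocks_ok_swap[OF ok] st(2) _ s, of i j] mn(2) sm i j ij False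
      unfolding block_inv_entry_sum[OF blocks_ok_swap[OF ok]]
      by (simp add: Un_commute min.commute)
    moreover have "row_sum (T \<union> S) ?w' i = row_sum (S \<union> T) ?w i"
      using sw i row_sum_cong[of "S \<union> T" ?w' i ?w] by (simp add: Un_commute)
    moreover have "row_sum (T \<union> S) (tr ?w') j = row_sum (S \<union> T) (tr ?w) j"
      using sw j row_sum_cong[of "S \<union> T" "tr ?w'" j "tr ?w"] by (simp add: Un_commute)
    ultimately show ?thesis using sw[OF i j] by simp
  qed
qed

lemma block_inv_potential:
  assumes ok: "blocks_ok S T v w1 w2 a b"
    and off: "\<And>i j. i \<in> S \<union> T \<Longrightarrow> j \<in> S \<union> T \<Longrightarrow> i \<noteq> j \<Longrightarrow> block_inv S T w1 w2 a b i j \<le> 0"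
  shows "potential_on (S \<union> T) v (block_inv S T w1 w2 a b)"
proof -
  have "0 \<le> v i j" if "i \<in> S \<union> T" "j \<in> S \<union> T" for i j
    using ok that by (auto simp: blocks_ok_def block_on_def bipotential_on_def potential_on_def)
  moreover have "0 \<le> row_sum (S \<union> T) (block_inv S T w1 w2 a b) i" if i: "i \<in> S \<union> T" for i
  proof (cases "i \<in> S")
    case True
    then show ?thesis
      unfolding block_inv_row_sum[OF ok True] using ok
      by (auto simp: blocks_ok_def bipotential_on_def potential_on_def
          intro!: divide_nonneg_nonneg mult_nonneg_nonneg)
  next
    case False
    then have "i \<in> T" using i by auto
    then show ?thesis
      unfolding block_inv_row_sum_swap[OF ok \<open>i \<in> T\<close>] using ok
      by (auto simp: blocks_ok_def bipotential_on_def potential_on_def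
          intro!: divide_nonneg_nonneg mult_nonneg_nonneg)
  qed
  ultimately show ?thesis
    using block_inv_right_inv[OF ok] off by (auto simp: potential_on_def)
qed

text \<open>This is the shift \<open>s = 0\<close>, admissible because the entries are
  nonnegative.\<close>

lemma shift_stable_off_diag:
  assumes "shift_stable S v w" "\<forall>i\<in>S. \<forall>j\<in>S. 0 \<le> v i j" "i \<in> S" "j \<in> S" "i \<noteq> j"
  shows "w i j \<le> 0"
  using assms(1)[unfolded shift_stable_def, rule_format, of 0 i j] assms by simp

lemma block_inv_bipotential:
  assumes ok: "blocks_ok S T v w1 w2 a b" and st: "shift_stable (S \<union> T) v (block_inv S T w1 w2 a b)"
  shows "bipotential_on (S \<union> T) v (block_inv S T w1 w2 a b)"
proof -
  have "\<forall>i\<in>S \<union> T. \<forall>j\<in>S \<union> T. 0 \<le> v i j"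
    using ok by (auto simp: blocks_ok_def block_on_def bipotential_on_def potential_on_def)
  note off = shift_stable_off_diag[OF st this]
  have "tr (block_inv S T w1 w2 a b) i j = block_inv S T (tr w1) (tr w2) b a i j" for i j
    using fun_cong[OF fun_cong[OF block_inv_tr[of S T w1 w2 a b], of i], of j] .
  then have "potential_on (S \<union> T) (tr v) (block_inv S T (tr w1) (tr w2) b a)"
    using off by (intro block_inv_potential[OF blocks_ok_tr[OF ok]]) metis
  then show ?thesis
    unfolding bipotential_on_def block_inv_tr using block_inv_potential[OF ok off] by simp
qed

section \<open>Convex images of entry sums\<close>

lemma convex_slopes_le:
  fixes f :: "real \<Rightarrow> real"
  assumes "convex_on I f" "x \<in> I" "y \<in> I" "x < t" "t < y"
  shows "(f t - f x) / (t - x) \<le> (f y - f t) / (y - t)"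
  using convex_on_slope_le[OF assms] by (metis (no_types, opaque_lifting) minus_diff_eq minus_divide_divide order_trans)

text \<open>Let \<open>p\<close> be the slope of the chord of \<open>f\<close> over
  \<open>[b, z]\<close>. By convexity, increments of \<open>f\<close> to the right of
  \<open>z\<close> are at least \<open>p\<close> times the length, and the one from \<open>a\<close>
  to \<open>z\<close> is at most that. Both products are compared with \<open>p\<close> squared
  times the common value in \<open>e\<close>.\<close>

lemma convex_cross_product_aux:
  fixes f :: "real \<Rightarrow> real"
  assumes f: "convex_on {0..} f" "mono_on {0..} f"
    and o: "0 \<le> a" "a \<le> b" "b \<le> z" "z \<le> x" "z \<le> y"
    and e: "(x - z) * (y - z) = (z - a) * (z - b)"
  shows "(f z - f a) * (f z - f b) \<le> (f x - f z) * (f y - f z)"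
\<comment> \<open>For \<open>b = z\<close> there is no chord, but the left side is 0 and the right
  side a product of nonnegative increments.\<close>
proof (cases "b = z")
  case True
  then show ?thesis
    using f(2) o by (auto simp: mono_on_def)
next
  case False
  then have bz: "b < z" using o by simp
  define p where "p = (f z - f b) / (z - b)"
  have p: "0 \<le> p" "f z - f b = p * (z - b)"
    unfolding p_def using f(2) o bz by (auto simp: mono_on_def)
  have up: "p * (t - z) \<le> f t - f z" if "z \<le> t" for t
  proof (cases "t = z")
    case False
    then have "p \<le> (f t - f z) / (t - z)"
      unfolding p_def using convex_slopes_le[OF f(1), of b t z] that o bz by simp
    then show ?thesis using False that by (simp add: field_simps)
  qed simp
  have lo: "f z - f a \<le> p * (z - a)"
  proof (cases "a = b")
    case False
    then have "(f a - f z) / (a - z) \<le> (f b - f z) / (b - z)"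
      using convex_on_slope_le(2)[OF f(1), of a z b] o bz by simp
    moreover have "(f b - f z) / (b - z) = p"
      unfolding p_def by (metis minus_diff_eq minus_divide_divide)
    ultimately show ?thesis using o bz by (simp add: field_simps)
  qed (use p in simp)
  have "(f z - f a) * (f z - f b) \<le> (p * (z - a)) * (p * (z - b))"
    unfolding p(2) using lo p(1) bz by (intro mult_right_mono) auto
  also have "\<dots> = (p * (x - z)) * (p * (y - z))"
    using e by (simp add: mult_ac)
  also have "\<dots> \<le> (f x - f z) * (f y - f z)"
    using up[of x] up[of y] p(1) f(2) o by (intro mult_mono) (auto simp: mono_on_def)
  finally show ?thesis .
qed

lemma convex_cross_product:
  fixes f :: "real \<Rightarrow> real"
  assumes "convex_on {0..} f" "mono_on {0..} f"
    and "0 \<le> a" "0 \<le> b" "a \<le> z" "b \<le> z" "z \<le> x" "z \<le> y"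
    and "(x - z) * (y - z) = (z - a) * (z - b)"
  shows "(f z - f a) * (f z - f b) \<le> (f x - f z) * (f y - f z)"
proof (cases "a \<le> b")
  case True
  then show ?thesis using assms by (intro convex_cross_product_aux) auto
next
  case False
  then have "(f z - f b) * (f z - f a) \<le> (f x - f z) * (f y - f z)"
    using assms by (intro convex_cross_product_aux) (auto simp: mult.commute)
  then show ?thesis by (simp add: mult.commute)
qed

text \<open>The expression is \<open>m1 * (1 - a * m2) + m2 * (1 - b * m1)\<close>, and both terms
  vanish only if \<open>a * b * m1 * m2 = 1\<close>.\<close>

lemma block_mass_pos:
  fixes a b m1 m2 :: real
  assumes "0 < m1" "0 < m2" "a * m2 \<le> 1" "b * m1 \<le> 1" "a * b * m1 * m2 < 1"
  shows "0 < m1 + m2 - (a + b) * m1 * m2"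
proof -
  have "\<not> (a * m2 = 1 \<and> b * m1 = 1)"
  proof
    assume "a * m2 = 1 \<and> b * m1 = 1"
    then have "(a * m2) * (b * m1) = 1" by simp
    then show False using assms(5) by (simp add: mult_ac)
  qed
  then have "0 < m1 * (1 - a * m2) + m2 * (1 - b * m1)"
    using assms by (cases "a * m2 = 1") (auto intro!: add_pos_nonneg[OF mult_pos_pos])
  then show ?thesis by (simp add: algebra_simps)
qed

text \<open>The numerical core of the induction: \<open>m1\<close>, \<open>m2\<close> stand for the
  entry sums of the inverses of the blocks of \<open>u\<close>, and \<open>n1\<close>,
  \<open>n2\<close> for those of its image under \<open>f\<close>. The first five conclusions are
  inequalities of \<open>blocks_ok\<close> for the image; the last one is the entry sum inequality
  for the whole matrix.\<close>

lemma block_mass_convex_image: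
  fixes f :: "real \<Rightarrow> real"
  assumes f: "convex_on {0..} f" "strict_mono_on {0..} f" "f \<in> {0..} \<rightarrow> {0..}"
    and m: "0 < m1" "0 < m2" and n: "0 < n1" "0 < n2" and ab: "0 \<le> a" "0 \<le> b"
    and le: "a * m1 \<le> 1" "b * m1 \<le> 1" "a * m2 \<le> 1" "b * m2 \<le> 1"
    and lt: "a * b * m1 * m2 < 1"
    and mn: "f (1 / m1) \<le> 1 / n1" "f (1 / m2) \<le> 1 / n2"
  shows "f a * n1 \<le> 1" "f b * n1 \<le> 1" "f a * n2 \<le> 1" "f b * n2 \<le> 1"
    and "f a * f b * n1 * n2 < 1"
    and "f (1 / ((m1 + m2 - (a + b) * m1 * m2) / (1 - a * b * m1 * m2)))
      \<le> 1 / ((n1 + n2 - (f a + f b) * n1 * n2) / (1 - f a * f b * n1 * n2))"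
proof -
  have mono: "mono_on {0..} f" using f(2) by (rule strict_mono_on_imp_mono_on)
  then have mo: "f s \<le> f t" if "0 \<le> s" "s \<le> t" for s t using that by (auto simp: mono_on_def)
  have smo: "f s < f t" if "0 \<le> s" "s < t" for s t using f(2) that by (auto simp: strict_mono_on_def)
  have f0: "0 \<le> f s" if "0 \<le> s" for s using f(3) that by auto
  have bound: "f c * k \<le> 1" if "0 \<le> c" "c * l \<le> 1" "0 < l" "0 < k" "f (1 / l) \<le> 1 / k" for c k l
  proof -
    have "f c \<le> f (1 / l)" using that by (intro mo) (auto simp: field_simps)
    also note that(5)
    finally show ?thesis using that by (simp add: field_simps)
  qed
  \<comment> \<open>Strict monotonicity of \<open>f\<close> keeps a strict inequality strict, which
    makes the denominator \<open>D'\<close> positive.\<close>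
  have sbound: "f c * k < 1" if "0 \<le> c" "c * l < 1" "0 < l" "0 < k" "f (1 / l) \<le> 1 / k" for c k l
  proof -
    have "f c < f (1 / l)" using that by (intro smo) (auto simp: field_simps)
    also note that(5)
    finally show ?thesis using that by (simp add: field_simps)
  qed
  show b: "f a * n1 \<le> 1" "f b * n1 \<le> 1" "f a * n2 \<le> 1" "f b * n2 \<le> 1"
    using bound ab le m n mn by blast+
  have "a * m1 < 1 \<or> b * m2 < 1"
  proof (rule ccontr)
    assume "\<not> (a * m1 < 1 \<or> b * m2 < 1)"
    then have "a * m1 = 1" "b * m2 = 1" using le by auto
    then have "(a * m1) * (b * m2) = 1" by simp
    then show False using lt by (simp add: mult_ac)
  qed
  then have "f a * n1 < 1 \<or> f b * n2 < 1"
    using sbound ab m n mn by blast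
  then have "(f a * n1) * (f b * n2) < 1"
  proof
    assume "f a * n1 < 1"
    moreover have "(f a * n1) * (f b * n2) \<le> f a * n1"
      using b(4) f0 ab n by (intro mult_left_le) auto
    ultimately show ?thesis by simp
  next
    assume "f b * n2 < 1"
    moreover have "(f a * n1) * (f b * n2) \<le> f b * n2"
      using b(1) f0 ab n by (intro mult_left_le_one_le) auto
    ultimately show ?thesis by simp
  qed
  then show lt': "f a * f b * n1 * n2 < 1" by (simp add: mult_ac)
  define D N z where "D = 1 - a * b * m1 * m2" and "N = m1 + m2 - (a + b) * m1 * m2" and "z = D / N"
  define D' N' where "D' = 1 - f a * f b * n1 * n2" and "N' = n1 + n2 - (f a + f b) * n1 * n2"
  have D: "0 < D" "0 < D'" using lt lt' by (auto simp: D_def D'_def)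
  have N: "0 < N" "0 < N'"
    unfolding N_def N'_def using block_mass_pos m n le b lt lt' by blast+
  \<comment> \<open>Here \<open>z\<close> is the reciprocal of the entry sum of the whole inverse.
    These factorizations place it above \<open>a\<close>, \<open>b\<close> and below
    \<open>1 / m1\<close>, \<open>1 / m2\<close>, and they turn both sides of the product identity
    into the same four factors over the square of \<open>N\<close>.\<close>
  have za: "z - a = (1 - a * m1) * (1 - a * m2) / N"
    unfolding z_def using N by (simp add: field_simps) (simp add: D_def N_def algebra_simps)
  have zb: "z - b = (1 - b * m1) * (1 - b * m2) / N"
    unfolding z_def using N by (simp add: field_simps) (simp add: D_def N_def algebra_simps)
  have zx: "1 / m1 - z = m2 * ((1 - a * m1) * (1 - b * m1)) / (m1 * N)"
    unfolding z_def using N m by (simp add: field_simps) (simp add: D_def N_def algebra_simps)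
  have zy: "1 / m2 - z = m1 * ((1 - a * m2) * (1 - b * m2)) / (m2 * N)"
    unfolding z_def using N m by (simp add: field_simps) (simp add: D_def N_def algebra_simps)
  have "0 \<le> z - a" "0 \<le> z - b" "0 \<le> 1 / m1 - z" "0 \<le> 1 / m2 - z"
    unfolding za zb zx zy using N m le
    by (auto intro!: divide_nonneg_nonneg mult_nonneg_nonneg)
  then have o: "a \<le> z" "b \<le> z" "z \<le> 1 / m1" "z \<le> 1 / m2" by auto
  have "(1 / m1 - z) * (1 / m2 - z) = (z - a) * (z - b)"
    unfolding za zb zx zy using m N by simp
  then have "(f z - f a) * (f z - f b) \<le> (f (1 / m1) - f z) * (f (1 / m2) - f z)"
    using convex_cross_product[OF f(1) mono ab o] by simp
  also have "\<dots> \<le> (1 / n1 - f z) * (1 / n2 - f z)"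
  proof (rule mult_mono)
    have z0: "0 \<le> z" using ab o by simp
    show "f (1 / m1) - f z \<le> 1 / n1 - f z" "f (1 / m2) - f z \<le> 1 / n2 - f z"
      using mn by auto
    show "0 \<le> 1 / n1 - f z" using mo[OF z0 o(3)] mn by simp
    show "0 \<le> f (1 / m2) - f z" using mo[OF z0 o(4)] by simp
  qed
  finally have "(f z - f a) * (f z - f b) * (n1 * n2) \<le> (1 / n1 - f z) * (1 / n2 - f z) * (n1 * n2)"
    using n by (intro mult_right_mono) auto
  also have "\<dots> = (1 - f z * n1) * (1 - f z * n2)"
    using n by (simp add: field_simps)
  \<comment> \<open>On expanding, the terms quadratic in \<open>f z\<close> cancel.\<close>
  finally have "f z * N' \<le> D'"
    by (simp add: D'_def N'_def algebra_simps)
  then have "f z \<le> D' / N'" using N by (simp add: field_simps)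
  then show "f (1 / ((m1 + m2 - (a + b) * m1 * m2) / (1 - a * b * m1 * m2)))
      \<le> 1 / ((n1 + n2 - (f a + f b) * n1 * n2) / (1 - f a * f b * n1 * n2))"
    by (simp add: z_def D_def N_def D'_def N'_def)
qed

section \<open>Increasing CBF matrices\<close>

inductive increasing_cbf_on :: "('i \<Rightarrow> 'i \<Rightarrow> real) \<Rightarrow> 'i set \<Rightarrow> bool" for u where
  single: "increasing_cbf_on u {i}"
| block: "increasing_cbf_on u S \<Longrightarrow> increasing_cbf_on u T \<Longrightarrow> block_on S T u a b \<Longrightarrow>
    \<forall>i\<in>S. \<forall>j\<in>S. min a b \<le> u i j \<Longrightarrow> \<forall>i\<in>T. \<forall>j\<in>T. min a b \<le> u i j \<Longrightarrow>
    increasing_cbf_on u (S \<union> T)"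

text \<open>The inverse \<open>w\<close> is kept arbitrary because each diagonal block has its own
  inverse. The induction carries shift stability for the signs and the entry sum inequality for the
  bounds on \<open>f a\<close> and \<open>f b\<close>.\<close>

lemma increasing_cbf_on_convex_image:
  assumes f: "convex_on {0..} f" "strict_mono_on {0..} f" "f \<in> {0..} \<rightarrow> {0..}"
    and "increasing_cbf_on u S" "bipotential_on S u w"
  shows "\<exists>w'. bipotential_on S (\<lambda>i j. f (u i j)) w' \<and> shift_stable S (\<lambda>i j. f (u i j)) w' \<and>
    f (1 / entry_sum S w) \<le> 1 / entry_sum S w'"
  using assms(4,5)
proof (induction arbitrary: w rule: increasing_cbf_on.induct)
  case (single i)
  then have u: "u i i * w i i = 1" "0 \<le> u i i"
    by (auto simp: bipotential_on_def potential_on_def right_inv_def)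
  \<comment> \<open>Strict monotonicity and \<open>0 \<le> f 0\<close> then make
    \<open>f (u i i)\<close> invertible. On a singleton shift stability is vacuous and the entry sum
    inequality is an equality.\<close>
  then have "0 < u i i" by (cases "u i i = 0") auto
  then have "f 0 < f (u i i)" using f(2) by (auto simp: strict_mono_on_def)
  moreover have "0 \<le> f 0" using f(3) by auto
  ultimately have fu: "0 < f (u i i)" by simp
  have "1 / w i i = u i i" using u by (metis div_by_0 eq_divide_eq mult_zero_right zero_neq_one)
  then show ?case
    using fu by (intro exI[of _ "\<lambda>_ _. 1 / f (u i i)"])
      (simp add: bipotential_on_def potential_on_def right_inv_def shift_stable_def entry_sum_def row_sum_def)
next
  case (block S T a b)
  let ?v = "\<lambda>i j. f (u i j)"
  note bp = \<open>bipotential_on (S \<union> T) u w\<close> and bl = \<open>block_on S T u a b\<close>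
  have fin: "finite S" "finite T" and ne: "S \<noteq> {}" "T \<noteq> {}" using bl by (auto simp: block_on_def)
  have u0: "\<forall>i\<in>S \<union> T. \<forall>j\<in>S \<union> T. 0 \<le> u i j"
    using bp by (auto simp: bipotential_on_def potential_on_def)
  note ab = block_nonneg[OF bl u0]
  obtain w1 where w1: "bipotential_on S u w1" "a * entry_sum S w1 \<le> 1" "b * entry_sum S w1 \<le> 1"
    using diagonal_block_bipotential[OF bp bl] by auto
  have "bipotential_on (T \<union> S) u w" "block_on T S u b a"
    using bp bl block_on_swap[of T S u b a] by (simp_all add: Un_commute)
  from diagonal_block_bipotential[OF this] obtain w2 where
    w2: "bipotential_on T u w2" "a * entry_sum T w2 \<le> 1" "b * entry_sum T w2 \<le> 1"
    by auto
  have pot: "potential_on S u w1" "potential_on T u w2"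
    using w1 w2 by (auto simp: bipotential_on_def)
  note bt = block_entry_sum[OF bp bl pot w1(2) w2(3)]
  from block.IH(1)[OF w1(1)] obtain w1' where w1': "bipotential_on S ?v w1'" "shift_stable S ?v w1'"
    "f (1 / entry_sum S w1) \<le> 1 / entry_sum S w1'"
    by auto
  from block.IH(2)[OF w2(1)] obtain w2' where w2': "bipotential_on T ?v w2'" "shift_stable T ?v w2'"
    "f (1 / entry_sum T w2) \<le> 1 / entry_sum T w2'"
    by auto
  have m: "0 < entry_sum S w1" "0 < entry_sum T w2"
    using entry_sum_pos pot fin ne by auto
  have n: "0 < entry_sum S w1'" "0 < entry_sum T w2'"
    using entry_sum_pos w1'(1) w2'(1) fin ne unfolding bipotential_on_def by blast+
  note im = block_mass_convex_image[OF f m n ab w1(2,3) w2(2,3) bt(1) w1'(3) w2'(3)]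
  \<comment> \<open>Increasingness passes to the image, as \<open>f\<close> is monotone on
    nonnegative arguments.\<close>
  have fm: "min (f a) (f b) \<le> f x" if "min a b \<le> x" for x
  proof -
    have "f (min a b) \<le> f x"
      using f(2)[THEN strict_mono_on_imp_mono_on] that ab by (auto simp: mono_on_def)
    then show ?thesis by (auto simp: min_def split: if_splits)
  qed
  have ok: "blocks_ok S T ?v w1' w2' (f a) (f b)"
    unfolding blocks_ok_def using bl ab f(3) im w1'(1) w2'(1) by (auto simp: block_on_def)
  have st: "shift_stable (S \<union> T) ?v (block_inv S T w1' w2' (f a) (f b))"
    using block.hyps fm by (intro block_inv_shift_stable[OF ok w1'(2) w2'(2)]) auto
  show ?case
    using block_inv_bipotential[OF ok st] st im(6)
    unfolding bt(2) block_inv_entry_sum[OF ok, symmetric] by blast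
qed

section \<open>Passage between matrices and functions on index sets\<close>

lemma increasing_cbf_imp_on:
  assumes "increasing_cbf U" "\<And>i j. i < dim_row U \<Longrightarrow> j < dim_row U \<Longrightarrow> u (k + i) (k + j) = U $$ (i, j)"
  shows "increasing_cbf_on u {k..<k + dim_row U}"
  using assms
\<comment> \<open>The offset \<open>k\<close> has to vary because the lower right block starts at
  row and column \<open>p\<close> of the surrounding matrix.\<close>
proof (induction arbitrary: k rule: increasing_cbf.induct)
  case (one A)
  then have "{k..<k + dim_row A} = {k}" by auto
  then show ?case by (simp add: increasing_cbf_on.single)
next
  case (block A B a b)
  define p q where "p = dim_row A" and "q = dim_row B"
  have A: "dim_row A = p" "dim_col A = p" "0 < p" and B: "dim_row B = q" "dim_col B = q" "0 < q"
    using block.hyps(1,2)[THEN increasing_cbf_imp_cbf, THEN cbf_square] by (auto simp: p_def q_def)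
  let ?U = "cbf_block A a b B"
  have d: "dim_row ?U = p + q" using A B by (simp add: cbf_block_def)
  note u = block.prems[unfolded d]
  have uA: "u (k + i) (k + j) = A $$ (i, j)" if "i < p" "j < p" for i j
    using u[of i j] that A B by (simp add: cbf_block_def)
  have uB: "u (k + p + i) (k + p + j) = B $$ (i, j)" if "i < q" "j < q" for i j
    using u[of "p + i" "p + j"] that A B by (simp add: cbf_block_def add.assoc)
  have ua: "u (k + i) (k + p + j) = a" if "i < p" "j < q" for i j
    using u[of i "p + j"] that A B by (simp add: cbf_block_def add.assoc)
  have ub: "u (k + p + i) (k + j) = b" if "i < q" "j < p" for i j
    using u[of "p + i" j] that A B by (simp add: cbf_block_def add.assoc)
  let ?S = "{k..<k + p}" and ?T = "{k + p..<k + p + q}"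
  have S: "\<exists>l<p. i = k + l" if "i \<in> ?S" for i using that by (auto intro: exI[of _ "i - k"])
  have T: "\<exists>l<q. i = k + p + l" if "i \<in> ?T" for i using that by (auto intro: exI[of _ "i - (k + p)"])
  have "increasing_cbf_on u ?S" using block.IH(1)[of k] uA A by simp
  moreover have "increasing_cbf_on u ?T" using block.IH(2)[of "k + p"] uB B by simp
  moreover have "u i j = a \<and> u j i = b" if "i \<in> ?S" "j \<in> ?T" for i j
    using S[OF that(1)] T[OF that(2)] ua ub by auto
  then have "block_on ?S ?T u a b" using A B by (auto simp: block_on_def)
  moreover have "min a b \<le> u i j" if ij: "i \<in> ?S" "j \<in> ?S" for i j
  proof -
    obtain l l' where "l < p" "l' < p" "u i j = A $$ (l, l')"
      using S[OF ij(1)] S[OF ij(2)] uA by blast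
    then show ?thesis using block.hyps(3) A elements_matI[of A p p l l'] by auto
  qed
  moreover have "min a b \<le> u i j" if ij: "i \<in> ?T" "j \<in> ?T" for i j
  proof -
    obtain l l' where "l < q" "l' < q" "u i j = B $$ (l, l')"
      using T[OF ij(1)] T[OF ij(2)] uB by blast
    then show ?thesis using block.hyps(3) B elements_matI[of B q q l l'] by auto
  qed
  ultimately have "increasing_cbf_on u (?S \<union> ?T)"
    by (intro increasing_cbf_on.block) auto
  moreover have "?S \<union> ?T = {k..<k + (p + q)}" by auto
  ultimately show ?case by (simp add: d)
qed

lemma inverts_mat_iff_right_inv:
  assumes "A \<in> carrier_mat n n" "B \<in> carrier_mat n n"
  shows "inverts_mat A B \<longleftrightarrow> right_inv {..<n} (\<lambda>i j. A $$ (i, j)) (\<lambda>i j. B $$ (i, j))"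
proof -
  have "(A * B) $$ (i, j) = (\<Sum>k<n. A $$ (i, k) * B $$ (k, j))" if "i < n" "j < n" for i j
    using assms that by (auto simp: scalar_prod_def atLeast0LessThan intro!: sum.cong)
  then show ?thesis
    using assms unfolding inverts_mat_def right_inv_def by (auto simp: mat_eq_iff)
qed

lemma inverts_mat_iff_left_inv:
  assumes "A \<in> carrier_mat n n" "B \<in> carrier_mat n n"
  shows "inverts_mat B A \<longleftrightarrow>
    right_inv {..<n} (tr (\<lambda>i j. A $$ (i, j))) (tr (\<lambda>i j. B $$ (i, j)))"
  unfolding inverts_mat_iff_right_inv[OF assms(2,1)] right_inv_def
  by (auto simp: mult.commute)

lemma bi_potential_iff_on:
  assumes V: "V \<in> carrier_mat n n"
  shows "bi_potential V \<longleftrightarrow> (\<exists>w. bipotential_on {..<n} (\<lambda>i j. V $$ (i, j)) w)"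
proof
  assume "bi_potential V"
  then obtain W where W: "W \<in> carrier_mat n n" "inverts_mat V W" "inverts_mat W V"
    "\<forall>i<n. \<forall>j<n. i \<noteq> j \<longrightarrow> W $$ (i, j) \<le> 0"
    "\<forall>i<n. 0 \<le> (\<Sum>j<n. W $$ (i, j))" "\<forall>j<n. 0 \<le> (\<Sum>i<n. W $$ (i, j))"
    and V0: "\<forall>x\<in>elements_mat V. 0 \<le> x"
    using V by (auto simp: bi_potential_def Let_def)
  have "\<forall>i<n. \<forall>j<n. 0 \<le> V $$ (i, j)"
    using V0 elements_matI[OF V] by auto
  then have "bipotential_on {..<n} (\<lambda>i j. V $$ (i, j)) (\<lambda>i j. W $$ (i, j))"
    using W inverts_mat_iff_right_inv[OF V W(1)] inverts_mat_iff_left_inv[OF V W(1)]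
    by (auto simp: bipotential_on_def potential_on_def row_sum_def)
  then show "\<exists>w. bipotential_on {..<n} (\<lambda>i j. V $$ (i, j)) w" by blast
next
  let ?v = "\<lambda>i j. V $$ (i, j)"
  assume "\<exists>w. bipotential_on {..<n} ?v w"
  then obtain w where w: "bipotential_on {..<n} ?v w" ..
  define W where "W = mat n n (\<lambda>(i, j). w i j)"
  have W: "W \<in> carrier_mat n n" and Wij: "\<And>i j. i < n \<Longrightarrow> j < n \<Longrightarrow> W $$ (i, j) = w i j"
    by (auto simp: W_def)
  have "potential_on {..<n} ?v (\<lambda>i j. W $$ (i, j))" "potential_on {..<n} (tr ?v) (\<lambda>i j. W $$ (j, i))"
    using w potential_on_cong[of "{..<n}" "\<lambda>i j. W $$ (i, j)" w ?v]
      potential_on_cong[of "{..<n}" "\<lambda>i j. W $$ (j, i)" "tr w" "tr ?v"] Wij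
    by (simp_all add: bipotential_on_def)
  note p = this
  have "inverts_mat V W" "inverts_mat W V"
    using p inverts_mat_iff_right_inv[OF V W] inverts_mat_iff_left_inv[OF V W]
    by (auto simp: potential_on_def)
  moreover have "\<forall>i<n. 0 < W $$ (i, i)"
    using potential_on_diag_pos[OF p(1)] by simp
  moreover have "\<forall>x\<in>elements_mat V. 0 \<le> x"
    using p(1) V by (auto simp: potential_on_def)
  moreover have "\<forall>i<n. \<forall>j<n. i \<noteq> j \<longrightarrow> W $$ (i, j) \<le> 0"
    "\<forall>i<n. 0 \<le> (\<Sum>j<n. W $$ (i, j))" "\<forall>j<n. 0 \<le> (\<Sum>i<n. W $$ (i, j))"
    using p by (simp_all add: potential_on_def row_sum_def)
  moreover have "square_mat V" "dim_row V = n" using V by auto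
  ultimately show "bi_potential V"
    unfolding bi_potential_def Let_def using W by blast
qed

theorem theorem2p7:
  fixes U :: "real mat" and f :: "real \<Rightarrow> real"
  assumes "bi_potential U" and "increasing_cbf U"
    and "f \<in> {0..} \<rightarrow> {0..}" and "strict_mono_on {0..} f" and "convex_on {0..} f"
  shows "bi_potential (map_mat f U)"
proof -
  define n where "n = dim_row U"
  have U: "U \<in> carrier_mat n n" using assms(1) by (auto simp: bi_potential_def n_def)
  let ?u = "\<lambda>i j. U $$ (i, j)"
  obtain w where "bipotential_on {..<n} ?u w"
    using assms(1) bi_potential_iff_on[OF U] by auto
  moreover have "increasing_cbf_on ?u {..<n}"
    using increasing_cbf_imp_on[OF assms(2), of ?u 0] by (simp add: n_def atLeast0LessThan)
  ultimately obtain w' where "bipotential_on {..<n} (\<lambda>i j. f (U $$ (i, j))) w'"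
    using increasing_cbf_on_convex_image[OF assms(5,4,3)] by blast
  then have w': "bipotential_on {..<n} (\<lambda>i j. f (?u i j)) w'" .
  have "bipotential_on {..<n} (\<lambda>i j. map_mat f U $$ (i, j)) w'"
    using w' U by (auto simp: bipotential_on_def potential_on_def right_inv_def)
  then show ?thesis
    using bi_potential_iff_on[of "map_mat f U" n] U by auto
qed

end
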